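(* Let $D(x)=1-58x-522x^2+729x^3$. Define integer sequences $(a_n),(b_n),(c_n)$ by the power series expansions about $x=0$ and rational sequences $(\alpha_n),(\beta_n),(\gamma_n)$ by the expansions about $x=\infty$ (in powers of $1/x$): \[ \frac{2-8x-90x^2}{D(x)}=\sum_{n\ge0}a_nx^n=\sum_{n\ge1}\alpha_{n-1}x^{-n}, \] \[ \frac{1+53x+9x^2}{D(x)}=\sum_{n\ge0}b_nx^n=\sum_{n\ge1}\beta_{n-1}x^{-n}, \] \[ \frac{2+22x-108x^2}{D(x)}=\sum_{n\ge0}c_nx^n=\sum_{n\ge1}\gamma_{n-1}x^{-n}. \] Then for all $n\ge0$, \[ a_n^3+b_n^3=c_n^3+\big((-9)^n\big)^3\quad\text{and}\quad \alpha_n^3+\beta_n^3=\gamma_n^3-\delta_n^3,\ \text{ where } \delta_n=(-1/9)^{n+1}. \] *)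

theory Defs
  imports "HOL-Computational_Algebra.Computational_Algebra"
begin

definition expansion_at_zero :: "rat poly \<Rightarrow> rat poly \<Rightarrow> rat fps" where
  "expansion_at_zero p q = fps_of_poly p / fps_of_poly q"

text \<open>
  The expansion of \<open>p(x) / q(x)\<close> about \<open>x = \<infinity>\<close> is a formal Laurent series in the
  variable \<open>t = 1/x\<close>; accordingly \<open>x\<close> is replaced by \<open>fls_X_inv\<close>, and the
  coefficient of \<open>x\<close> to the power \<open>-n\<close> is the \<open>n\<close>-th coefficient of the series.
\<close>

definition expansion_at_infinity :: "rat poly \<Rightarrow> rat poly \<Rightarrow> rat fls" where
  "expansion_at_infinity p q =
     poly (map_poly fls_const p) fls_X_inv / poly (map_poly fls_const q) fls_X_inv"

definition denom_D :: "rat poly" where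
  "denom_D = [:1, -58, -522, 729:]"

definition numer_a :: "rat poly" where
  "numer_a = [:2, -8, -90:]"

definition numer_b :: "rat poly" where
  "numer_b = [:1, 53, 9:]"

definition numer_c :: "rat poly" where
  "numer_c = [:2, 22, -108:]"

definition seq_a :: "nat \<Rightarrow> rat" where
  "seq_a n = fps_nth (expansion_at_zero numer_a denom_D) n"

definition seq_b :: "nat \<Rightarrow> rat" where
  "seq_b n = fps_nth (expansion_at_zero numer_b denom_D) n"

definition seq_c :: "nat \<Rightarrow> rat" where
  "seq_c n = fps_nth (expansion_at_zero numer_c denom_D) n"

definition seq_alpha :: "nat \<Rightarrow> rat" where
  "seq_alpha n = fls_nth (expansion_at_infinity numer_a denom_D) (int n + 1)"

definition seq_beta :: "nat \<Rightarrow> rat" where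
  "seq_beta n = fls_nth (expansion_at_infinity numer_b denom_D) (int n + 1)"

definition seq_gamma :: "nat \<Rightarrow> rat" where
  "seq_gamma n = fls_nth (expansion_at_infinity numer_c denom_D) (int n + 1)"

definition seq_delta :: "nat \<Rightarrow> rat" where
  "seq_delta n = (- 1 / 9) ^ (n + 1)"

text \<open>
  The expansions at infinity contain no non-negative powers of \<open>x\<close>, so the sequences
  above really are all of their coefficients; \<open>fls_X * fps_to_fls (Abs_fps f)\<close> is the
  sum of \<open>f (n - 1) * t ^ n\<close> over \<open>n \<ge> 1\<close>.
\<close>

lemma poly_at_infinity_nth:
  "fls_nth (poly (map_poly fls_const [:p0, p1, p2, p3:]) fls_X_inv :: rat fls) k =
     (if k = 0 then p0 else if k = -1 then p1 else if k = -2 then p2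
      else if k = -3 then p3 else 0)"
  by (auto simp: map_poly_pCons fls_X_inv_times_conv_shift algebra_simps)

lemma expansion_at_infinity_nth_nonpos:
  assumes "k \<le> 0"
  shows "fls_nth (expansion_at_infinity [:p0, p1, p2:] denom_D) k = 0"
proof -
  let ?P = "poly (map_poly fls_const [:p0, p1, p2, 0:]) fls_X_inv :: rat fls"
  let ?Q = "poly (map_poly fls_const [:1, -58, -522, 729:]) fls_X_inv :: rat fls"
  have Q: "fls_subdegree ?Q = -3"
    by (rule fls_subdegree_eqI) (simp_all only: poly_at_infinity_nth, auto)
  show ?thesis
  proof (cases "?P = 0")
    case True
    then show ?thesis by (simp add: expansion_at_infinity_def)
  next
    case False
    have nz: "?Q \<noteq> 0" using Q by fastforce
    have ge: "-2 \<le> fls_subdegree ?P"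
      by (rule fls_subdegree_geI[OF False]) (simp only: poly_at_infinity_nth, auto)
    have subdegree_quot: "fls_subdegree (p / q) = fls_subdegree p - fls_subdegree q"
      if "p \<noteq> 0" "q \<noteq> 0" for p q :: "rat fls"
      using fls_subdegree_mult[of "p / q" q] that by auto
    have "1 \<le> fls_subdegree (?P / ?Q)"
      unfolding subdegree_quot[OF False nz] Q using ge by linarith
    then have "fls_nth (?P / ?Q) k = 0"
      using assms by (intro fls_eq0_below_subdegree) linarith
    then show ?thesis by (simp add: expansion_at_infinity_def denom_D_def)
  qed
qed

lemma expansion_at_infinity_shift:
  "expansion_at_infinity [:p0, p1, p2:] denom_D =
     fls_X * fps_to_fls (Abs_fps (\<lambda>n. fls_nth
       (expansion_at_infinity [:p0, p1, p2:] denom_D) (int n + 1)))"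
  by (rule fls_eqI)
     (auto simp: fls_X_times_conv_shift expansion_at_infinity_nth_nonpos)

lemma expansions_at_infinity:
  "expansion_at_infinity numer_a denom_D = fls_X * fps_to_fls (Abs_fps seq_alpha)"
  "expansion_at_infinity numer_b denom_D = fls_X * fps_to_fls (Abs_fps seq_beta)"
  "expansion_at_infinity numer_c denom_D = fls_X * fps_to_fls (Abs_fps seq_gamma)"
  unfolding seq_alpha_def seq_beta_def seq_gamma_def numer_a_def numer_b_def numer_c_def
  by (rule expansion_at_infinity_shift)+

end

theory Submission
  imports Defs
begin

text \<open>
  Since \<open>D = (1 + 9x)(1 - 67x + 81x\<^sup>2)\<close>, the reciprocals of the roots of \<open>D\<close> are \<open>\<lambda>\<^sup>2\<close>, \<open>\<lambda>\<mu>\<close> and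
  \<open>\<mu>\<^sup>2\<close>, where \<open>\<lambda> + \<mu> = 7\<close> and \<open>\<lambda>\<mu> = -9\<close>. Hence the Taylor coefficients of any quadratic numerator
  over \<open>D\<close> are the values of a binary quadratic form at consecutive terms \<open>(p\<^sub>n, p\<^sub>n\<^sub>+\<^sub>1)\<close> of the
  Lucas sequence of \<open>t\<^sup>2 - 7t - 9\<close>. The form \<open>y\<^sup>2 - 7xy - 9x\<^sup>2\<close> takes the value \<open>(-9)\<^sup>n\<close> there, and
  the theorem becomes an identity between cubes of quadratic forms. The coefficients at infinity
  are the negatives of the Taylor coefficients continued to negative indices, where
  \<open>p\<^sub>-\<^sub>n = - p\<^sub>n / (-9)\<^sup>n\<close>, so the same identity applies.
\<close>

fun lucas :: "nat \<Rightarrow> int" where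
  "lucas 0 = 0"
| "lucas (Suc 0) = 1"
| "lucas (Suc (Suc n)) = 7 * lucas (Suc n) + 9 * lucas n"

definition form :: "'a::comm_ring_1 \<Rightarrow> 'a \<Rightarrow> 'a \<Rightarrow> 'a \<Rightarrow> 'a \<Rightarrow> 'a" where
  "form u v w x y = u * x\<^sup>2 + v * x * y + w * y\<^sup>2"

definition lucas_form :: "rat \<Rightarrow> rat \<Rightarrow> rat \<Rightarrow> nat \<Rightarrow> rat" where
  "lucas_form u v w n = form u v w (of_int (lucas n)) (of_int (lucas (Suc n)))"

text \<open>The triples (10, 0, 2), (-1, 9, 1), (12, 4, 2) solve
  \<open>[:w, u + 7 * v - 9 * w, -9 * u:]\<close> = \<open>numer_a\<close>, \<open>numer_b\<close>,
  \<open>numer_c\<close>.\<close>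

lemma form_cubes:
  "form 10 0 2 x y ^ 3 + form (-1) 9 1 x y ^ 3 =
   form 12 4 2 x y ^ 3 + form (-9) (-7) 1 x y ^ 3"
  unfolding form_def by (simp add: power2_eq_square power3_eq_cube algebra_simps)

text \<open>The form is (y - \<lambda>x)(y - \<mu>x); a step of the recurrence multiplies the
  factors by \<mu> and \<lambda>, hence the form by -9.\<close>

lemma lucas_invariant: "lucas_form (-9) (-7) 1 n = (-9) ^ n"
proof (induction n)
  case 0
  show ?case by (simp add: lucas_form_def form_def)
next
  case (Suc n)
  have "lucas_form (-9) (-7) 1 (Suc n) = - 9 * lucas_form (-9) (-7) 1 n"
    unfolding lucas_form_def form_def
    by (simp add: power2_eq_square algebra_simps)
  with Suc show ?case by simp
qed

lemma lucas_form_in_Ints: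
  assumes "u \<in> \<int>" "v \<in> \<int>" "w \<in> \<int>"
  shows "lucas_form u v w n \<in> \<int>"
  using assms unfolding lucas_form_def form_def by auto

lemma lucas_form_rec:
  "lucas_form u v w (Suc (Suc (Suc n))) =
     58 * lucas_form u v w (Suc (Suc n)) + 522 * lucas_form u v w (Suc n) - 729 * lucas_form u v w n"
  unfolding lucas_form_def form_def by (simp add: power2_eq_square algebra_simps)

lemma fps_mult_denom_D_nth:
  "fps_nth (f * fps_of_poly denom_D) n =
     fps_nth f n - (if n < 1 then 0 else 58 * fps_nth f (n - 1))
       - (if n < 2 then 0 else 522 * fps_nth f (n - 2))
       + (if n < 3 then 0 else 729 * fps_nth f (n - 3))"
proof -
  have "f * fps_of_poly denom_D =
      f - fps_const 58 * (f * fps_X) - fps_const 522 * (f * fps_X ^ 2) + fps_const 729 * (f * fps_X ^ 3)"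
    by (simp add: denom_D_def fps_of_poly_pCons algebra_simps power2_eq_square power3_eq_cube
      flip: fps_const_neg)
  then show ?thesis
    by (simp add: fps_X_power_mult_right_nth)
qed

text \<open>Multiplying the series by \<open>denom_D\<close> kills all coefficients from degree 3
  on, by \<open>lucas_form_rec\<close>; the numerator is what remains.\<close>

lemma expansion_at_zero_denom_D:
  "expansion_at_zero [:w, u + 7 * v - 9 * w, -9 * u:] denom_D = Abs_fps (lucas_form u v w)"
proof -
  have "fps_of_poly [:w, u + 7 * v - 9 * w, -9 * u:] = Abs_fps (lucas_form u v w) * fps_of_poly denom_D"
  proof (rule fps_ext)
    fix n
    consider "n = 0" | "n = 1" | "n = 2" | m where "n = Suc (Suc (Suc m))"
      by (metis One_nat_def Suc_1 not0_implies_Suc)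
    then show "fps_nth (fps_of_poly [:w, u + 7 * v - 9 * w, -9 * u:]) n =
        fps_nth (Abs_fps (lucas_form u v w) * fps_of_poly denom_D) n"
    proof cases
      case 4
      then show ?thesis
        unfolding fps_mult_denom_D_nth by (simp add: lucas_form_rec)
    qed (simp_all add: fps_mult_denom_D_nth lucas_form_def form_def numeral_2_eq_2
      del: fps_mult_nth_0 fps_mult_nth_1 fps_mult_nth_1')
  qed
  moreover have "fps_of_poly denom_D \<noteq> 0"
    by (simp add: denom_D_def)
  ultimately show ?thesis
    by (simp add: expansion_at_zero_def)
qed

text \<open>Clear the denominator: index k belongs to x^(-k), so each factor x shifts the index by
  one.\<close>

lemma expansion_at_infinity_denom_D_rec:
  fixes p0 p1 p2 :: rat
  defines "E \<equiv> fls_nth (expansion_at_infinity [:p0, p1, p2:] denom_D)"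
  shows "E k - 58 * E (k + 1) - 522 * E (k + 2) + 729 * E (k + 3) =
    (if k = 0 then p0 else if k = -1 then p1 else if k = -2 then p2 else 0)"
proof -
  let ?at_inf = "\<lambda>p. poly (map_poly fls_const p) fls_X_inv :: rat fls"
  let ?E = "expansion_at_infinity [:p0, p1, p2:] denom_D"
  have "fls_nth (?at_inf denom_D) 0 \<noteq> 0"
    unfolding denom_D_def poly_at_infinity_nth by simp
  then have "?at_inf denom_D \<noteq> 0"
    by auto
  then have "?at_inf [:p0, p1, p2, 0:] = ?E * ?at_inf denom_D"
    by (simp add: expansion_at_infinity_def)
  also have "\<dots> = ?E - fls_const 58 * (fls_X_inv * ?E) - fls_const 522 * (fls_X_inv * (fls_X_inv * ?E))
      + fls_const 729 * (fls_X_inv * (fls_X_inv * (fls_X_inv * ?E)))"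
    by (simp add: denom_D_def map_poly_pCons algebra_simps)
  also have "\<dots> = ?E - fls_const 58 * fls_shift 1 ?E - fls_const 522 * fls_shift 2 ?E
      + fls_const 729 * fls_shift 3 ?E"
    by (simp add: fls_X_inv_times_conv_shift)
  finally have "fls_nth (?at_inf [:p0, p1, p2, 0:]) k = fls_nth \<dots> k"
    by simp
  then show ?thesis
    unfolding poly_at_infinity_nth E_def by (simp split: if_splits)
qed

text \<open>Inserting the values at indices -n-1 and -n into the form swaps u and w; the common
  denominator 81^(n+1) leaves the factors 81 and -9.\<close>

lemma expansion_at_infinity_denom_D_nth:
  "fls_nth (expansion_at_infinity [:w, u + 7 * v - 9 * w, -9 * u:] denom_D) (int n + 1) =
     - lucas_form (81 * w) (-9 * v) u n / 81 ^ (n + 1)"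
proof -
  define E where "E = fls_nth (expansion_at_infinity [:w, u + 7 * v - 9 * w, -9 * u:] denom_D)"
  note rec = expansion_at_infinity_denom_D_rec[of w "u + 7 * v - 9 * w" "-9 * u", folded E_def]
  have E_nonpos: "E k = 0" if "k \<le> 0" for k
    unfolding E_def using that by (rule expansion_at_infinity_nth_nonpos)
  \<comment> \<open>As E vanishes at nonpositive indices, k = -2, -1, 0 yield E 1, E 2, E 3 in
    turn.\<close>
  have E1: "E 1 = - u / 81"
    using rec[of "-2"] by (simp add: E_nonpos)
  have E2: "E 2 = (- u * 49 + 63 * v - 81 * w) / 81 ^ 2"
    using rec[of "-1"] E1 by (simp add: E_nonpos field_simps)
  have E3: "E 3 = - lucas_form (81 * w) (-9 * v) u 2 / 81 ^ 3"
    using rec[of "0"] E1 E2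
    by (simp add: E_nonpos field_simps lucas_form_def form_def numeral_2_eq_2)
  show ?thesis
    unfolding E_def[symmetric]
  proof (induction n rule: less_induct)
    case (less n)
    consider "n = 0" | "n = 1" | "n = 2" | m where "n = Suc (Suc (Suc m))"
      by (metis One_nat_def Suc_1 not0_implies_Suc)
    then show ?case
    proof cases
      case 4
      have IH: "E (int m + 1) = - lucas_form (81 * w) (-9 * v) u m / 81 ^ (m + 1)"
        "E (int (Suc m) + 1) = - lucas_form (81 * w) (-9 * v) u (Suc m) / 81 ^ (Suc m + 1)"
        "E (int (Suc (Suc m)) + 1) = - lucas_form (81 * w) (-9 * v) u (Suc (Suc m)) / 81 ^ (Suc (Suc m) + 1)"
        using 4 by (intro less.IH; simp)+
      \<comment> \<open>Scaling by powers of 81 turns the backward recurrence into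
        \<open>lucas_form_rec\<close>: 522 * 81 / 729 = 58, 58 * 81^2 / 729 = 522 and 81^3 / 729 =
        729.\<close>
      have "E (int n + 1) = (522 * E (int (Suc (Suc m)) + 1) + 58 * E (int (Suc m) + 1) - E (int m + 1)) / 729"
        using rec[of "int m + 1"] 4 by (simp add: add_ac)
      also have "\<dots> = - lucas_form (81 * w) (-9 * v) u n / 81 ^ (n + 1)"
        unfolding IH 4 lucas_form_rec by (simp add: field_simps)
      finally show ?thesis .
    qed (simp_all add: E1 E2 E3 lucas_form_def form_def field_simps)
  qed
qed

lemma expansions_nth:
  "seq_a n = lucas_form 10 0 2 n"
  "seq_b n = lucas_form (-1) 9 1 n"
  "seq_c n = lucas_form 12 4 2 n"
  "seq_alpha n = - lucas_form 162 0 10 n / 81 ^ (n + 1)"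
  "seq_beta n = - lucas_form 81 (-81) (-1) n / 81 ^ (n + 1)"
  "seq_gamma n = - lucas_form 162 (-36) 12 n / 81 ^ (n + 1)"
  using expansion_at_zero_denom_D[of 2 10 0] expansion_at_zero_denom_D[of 1 "-1" 9]
    expansion_at_zero_denom_D[of 2 12 4]
    expansion_at_infinity_denom_D_nth[of 2 10 0] expansion_at_infinity_denom_D_nth[of 1 "-1" 9]
    expansion_at_infinity_denom_D_nth[of 2 12 4]
  by (simp_all add: seq_a_def seq_b_def seq_c_def seq_alpha_def seq_beta_def seq_gamma_def
    numer_a_def numer_b_def numer_c_def)

theorem theorem2p4:
  shows "(\<forall>n. seq_a n \<in> \<int> \<and> seq_b n \<in> \<int> \<and> seq_c n \<in> \<int>) \<and>
         (\<forall>n. seq_a n ^ 3 + seq_b n ^ 3 = seq_c n ^ 3 + ((- 9) ^ n) ^ 3 \<and>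
              seq_alpha n ^ 3 + seq_beta n ^ 3 = seq_gamma n ^ 3 - seq_delta n ^ 3)"
proof (intro conjI allI)
  fix n
  show "seq_a n \<in> \<int>" "seq_b n \<in> \<int>" "seq_c n \<in> \<int>"
    unfolding expansions_nth by (simp_all add: lucas_form_in_Ints)
  show "seq_a n ^ 3 + seq_b n ^ 3 = seq_c n ^ 3 + ((- 9) ^ n) ^ 3"
    unfolding expansions_nth lucas_invariant[symmetric] lucas_form_def by (rule form_cubes)
  \<comment> \<open>This is the pair of Lucas terms at indices -n-1 and -n, times
    (-9)^(n+1).\<close>
  define x y :: rat where "x = - of_int (lucas (Suc n))" and "y = 9 * of_int (lucas n)"
  have reflect: "lucas_form (81 * w) (- 9 * v) u n = form u v w x y" for u v w
    by (simp add: lucas_form_def form_def x_def y_def power2_eq_square)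
  have "form (-9) (-7) 1 x y = - 9 * lucas_form (-9) (-7) 1 n"
    by (simp add: lucas_form_def form_def x_def y_def power2_eq_square algebra_simps)
  also have "\<dots> = (- 9) ^ (n + 1)"
    by (simp add: lucas_invariant)
  \<comment> \<open>No minus sign here, unlike the other three sequences: hence the changed sign of
    the delta cube.\<close>
  finally have "seq_delta n = form (-9) (-7) 1 x y / 81 ^ (n + 1)"
    by (simp add: seq_delta_def flip: power_divide power_Suc)
  moreover have "seq_alpha n = - form 10 0 2 x y / 81 ^ (n + 1)"
    "seq_beta n = - form (-1) 9 1 x y / 81 ^ (n + 1)"
    "seq_gamma n = - form 12 4 2 x y / 81 ^ (n + 1)"
    using reflect[of 2 0 10] reflect[of 1 9 "-1"] reflect[of 2 4 12]
    by (simp_all add: expansions_nth)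
  ultimately have "seq_alpha n ^ 3 + seq_beta n ^ 3 - (seq_gamma n ^ 3 - seq_delta n ^ 3) =
      (form 12 4 2 x y ^ 3 + form (-9) (-7) 1 x y ^ 3
        - (form 10 0 2 x y ^ 3 + form (-1) 9 1 x y ^ 3)) / (81 ^ (n + 1)) ^ 3"
    by (simp add: power_divide power_mult_distrib add_divide_distrib diff_divide_distrib)
  then show "seq_alpha n ^ 3 + seq_beta n ^ 3 = seq_gamma n ^ 3 - seq_delta n ^ 3"
    by (simp add: form_cubes)
qed

end
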